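(* Let $C\subseteq D$ be a unital irreducible inclusion of $\mathrm{C}^*$-algebras acting on a separable Hilbert space $H$. Let $A$ and $B$ be separable intermediate $\mathrm{C}^*$-subalgebras for $C\subseteq D$ (that is, $C\subseteq A\subseteq D$ and $C\subseteq B\subseteq D$), and suppose there is a conditional expectation from $D$ onto $B$. Suppose that $C\subseteq A$ is crossed product-like by a discrete amenable group and that $d(A,B)<140^{-1}$. Then $A=B$.
   Context: For a $\mathrm{C}^*$-algebra $A$, $A_1$ denotes its unit ball and $A^u$ its group of unitaries. For $\mathrm{C}^*$-subalgebras $A,B$ of a $\mathrm{C}^*$-algebra, $d(A,B):=\max\{\sup_{a\in A_1}\inf_{b\in B_1}\|a-b\|,\ \sup_{b\in B_1}\inf_{a\in A_1}\|a-b\|\}$. A unital inclusion $C\subseteq D$ is irreducible if the relative commutant is trivial: $C'\cap D=\mathbb{C}I$. For an inclusion $A\subseteq B$, the normalizer is $\mathcal{N}_B(A)=\{u\in B^u: uAu^*=A\}$. A unital inclusion $A\subseteq B$ of $\mathrm{C}^*$-algebras is crossed product-like (by $U$) if there is a group $U\subseteq\mathcal{N}_B(A)$ (a subgroup, regarded as a discrete group) with $B=C^*(A,U)$, the $\mathrm{C}^*$-algebra generated by $A$ and $U$; it is crossed product-like by a discrete amenable group if such a $U$ can be taken amenable as a discrete group. *)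

theory Defs
  imports "HOL-Analysis.Analysis" "HOL-Algebra.Group"
begin

text \<open>
  Complex Hilbert spaces. The inner product is linear in its first argument. Definiteness of
  \<open>cinner\<close>, completeness and compatibility with the real structure come from class \<open>banach\<close>.
\<close>

class complex_hilbert_space = banach +
  fixes scaleC :: "complex \<Rightarrow> 'a \<Rightarrow> 'a"  (infixr \<open>*\<^sub>C\<close> 75)
    and cinner :: "'a \<Rightarrow> 'a \<Rightarrow> complex"
  assumes scaleC_add_right: "z *\<^sub>C (x + y) = z *\<^sub>C x + z *\<^sub>C y"
    and scaleC_add_left: "(z + w) *\<^sub>C x = z *\<^sub>C x + w *\<^sub>C x"
    and scaleC_scaleC: "z *\<^sub>C (w *\<^sub>C x) = (z * w) *\<^sub>C x"
    and scaleC_of_real: "complex_of_real r *\<^sub>C x = r *\<^sub>R x"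
    and cinner_commute: "cinner x y = cnj (cinner y x)"
    and cinner_add_left: "cinner (x + y) v = cinner x v + cinner y v"
    and cinner_scaleC_left: "cinner (z *\<^sub>C x) v = z * cinner x v"
    and cinner_self: "cinner x x = complex_of_real ((norm x)\<^sup>2)"

instantiation complex :: complex_hilbert_space
begin

definition scaleC_complex :: "complex \<Rightarrow> complex \<Rightarrow> complex"
  where "scaleC_complex z x = z * x"

definition cinner_complex :: "complex \<Rightarrow> complex \<Rightarrow> complex"
  where "cinner_complex x y = x * cnj y"

instance
  by standard
    (simp_all add: scaleC_complex_def cinner_complex_def distrib_left distrib_right
      scaleR_conv_of_real complex_mult_cnj cmod_def)

end

lemma norm_scaleC: "norm (z *\<^sub>C x) = norm z * norm (x :: 'a::complex_hilbert_space)"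
proof -
  have "cinner x (z *\<^sub>C x) = cnj z * cinner x x"
    unfolding cinner_commute[of x "z *\<^sub>C x"] cinner_scaleC_left complex_cnj_mult
    by (simp only: cinner_commute[of x x, symmetric])
  then have "cinner (z *\<^sub>C x) (z *\<^sub>C x) = z * (cnj z * cinner x x)"
    by (simp only: cinner_scaleC_left)
  also have "\<dots> = complex_of_real ((norm z * norm x)\<^sup>2)"
    unfolding cinner_self power_mult_distrib of_real_mult complex_norm_square[of z]
    by (simp only: mult.assoc)
  finally have "(norm (z *\<^sub>C x))\<^sup>2 = (norm z * norm x)\<^sup>2"
    unfolding cinner_self of_real_eq_iff .
  then show ?thesis
    by (rule power2_eq_imp_eq) simp_all
qed

text \<open>
  Operators are elements of \<open>'h \<Rightarrow>\<^sub>L 'h\<close>, the real-linear bounded operators with the operator norm;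
  $B(H)$ is the subset of complex-linear ones.
\<close>

definition bounded_operators :: "('h::complex_hilbert_space \<Rightarrow>\<^sub>L 'h) set"
  where "bounded_operators = {T :: 'h \<Rightarrow>\<^sub>L 'h. \<forall>z x. T (z *\<^sub>C x) = z *\<^sub>C T x}"

lift_definition scaleC_op ::
    "complex \<Rightarrow> ('h::complex_hilbert_space \<Rightarrow>\<^sub>L 'h) \<Rightarrow> ('h \<Rightarrow>\<^sub>L 'h)"
  is "\<lambda>z T x. z *\<^sub>C T x"
proof -
  fix z :: complex and T :: "'h \<Rightarrow> 'h"
  assume T: "bounded_linear T"
  have "bounded_linear (\<lambda>x::'h. z *\<^sub>C x)"
  proof (rule bounded_linear_intro[where K = "norm z"])
    show "z *\<^sub>C (r *\<^sub>R x) = r *\<^sub>R (z *\<^sub>C x)" for r and x :: 'h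
      unfolding scaleC_of_real[symmetric] scaleC_scaleC by (simp only: mult.commute)
  qed (simp_all add: scaleC_add_right norm_scaleC mult.commute)
  from bounded_linear_compose[OF this T] show "bounded_linear (\<lambda>x. z *\<^sub>C T x)" .
qed

text \<open>Meaningful for \<open>T \<in> bounded_operators\<close>, where the adjoint exists and is unique.\<close>

definition cadjoint :: "('h::complex_hilbert_space \<Rightarrow>\<^sub>L 'h) \<Rightarrow> ('h \<Rightarrow>\<^sub>L 'h)"
  where "cadjoint T = (THE S :: 'h \<Rightarrow>\<^sub>L 'h. \<forall>x y. cinner (T x) y = cinner x (S y))"

definition positive_op :: "('h::complex_hilbert_space \<Rightarrow>\<^sub>L 'h) \<Rightarrow> bool"
  where "positive_op T \<longleftrightarrow> (\<forall>x. cinner (T x) x \<in> \<real>\<^sub>\<ge>\<^sub>0)"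

definition cstar_subalgebra :: "('h::complex_hilbert_space \<Rightarrow>\<^sub>L 'h) set \<Rightarrow> bool"
  where "cstar_subalgebra A \<longleftrightarrow>
    A \<subseteq> bounded_operators \<and> 0 \<in> A \<and>
    (\<forall>S\<in>A. \<forall>T\<in>A. S + T \<in> A) \<and>
    (\<forall>z. \<forall>T\<in>A. scaleC_op z T \<in> A) \<and>
    (\<forall>S\<in>A. \<forall>T\<in>A. S o\<^sub>L T \<in> A) \<and>
    (\<forall>T\<in>A. cadjoint T \<in> A) \<and>
    closed A"

text \<open>
  The unit of an algebra of operators is its own multiplicative identity; algebras are not assumed
  to act nondegenerately, so it may be a proper projection on the Hilbert space.
\<close>

definition is_unit_of :: "('h::complex_hilbert_space \<Rightarrow>\<^sub>L 'h) \<Rightarrow> ('h \<Rightarrow>\<^sub>L 'h) set \<Rightarrow> bool"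
  where "is_unit_of e A \<longleftrightarrow> e \<in> A \<and> (\<forall>T\<in>A. e o\<^sub>L T = T \<and> T o\<^sub>L e = T)"

definition unit_of :: "('h::complex_hilbert_space \<Rightarrow>\<^sub>L 'h) set \<Rightarrow> ('h \<Rightarrow>\<^sub>L 'h)"
  where "unit_of A = (THE e. is_unit_of e A)"

definition unital_inclusion ::
    "('h::complex_hilbert_space \<Rightarrow>\<^sub>L 'h) set \<Rightarrow> ('h \<Rightarrow>\<^sub>L 'h) set \<Rightarrow> bool"
  where "unital_inclusion C D \<longleftrightarrow>
    cstar_subalgebra C \<and> cstar_subalgebra D \<and> C \<subseteq> D \<and> (\<exists>e\<in>C. is_unit_of e D)"

definition relative_commutant ::
    "('h::complex_hilbert_space \<Rightarrow>\<^sub>L 'h) set \<Rightarrow> ('h \<Rightarrow>\<^sub>L 'h) set \<Rightarrow> ('h \<Rightarrow>\<^sub>L 'h) set"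
  where "relative_commutant C D = {T \<in> D. \<forall>S\<in>C. T o\<^sub>L S = S o\<^sub>L T}"

definition irreducible_inclusion ::
    "('h::complex_hilbert_space \<Rightarrow>\<^sub>L 'h) set \<Rightarrow> ('h \<Rightarrow>\<^sub>L 'h) set \<Rightarrow> bool"
  where "irreducible_inclusion C D \<longleftrightarrow>
    unital_inclusion C D \<and> relative_commutant C D = range (\<lambda>z. scaleC_op z (unit_of D))"

definition unit_ball :: "('h::complex_hilbert_space \<Rightarrow>\<^sub>L 'h) set \<Rightarrow> ('h \<Rightarrow>\<^sub>L 'h) set"
  where "unit_ball A = {T \<in> A. norm T \<le> 1}"

text \<open>
  For subalgebras the suprema and infima are taken over nonempty sets of reals in \<open>{0..2}\<close>.
\<close>

definition cstar_dist ::
    "('h::complex_hilbert_space \<Rightarrow>\<^sub>L 'h) set \<Rightarrow> ('h \<Rightarrow>\<^sub>L 'h) set \<Rightarrow> real"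
  where "cstar_dist A B =
    max (SUP a\<in>unit_ball A. INF b\<in>unit_ball B. norm (a - b))
        (SUP b\<in>unit_ball B. INF a\<in>unit_ball A. norm (a - b))"

definition unitaries :: "('h::complex_hilbert_space \<Rightarrow>\<^sub>L 'h) set \<Rightarrow> ('h \<Rightarrow>\<^sub>L 'h) set"
  where "unitaries A =
    {u \<in> A. cadjoint u o\<^sub>L u = unit_of A \<and> u o\<^sub>L cadjoint u = unit_of A}"

definition unitary_group :: "('h::complex_hilbert_space \<Rightarrow>\<^sub>L 'h) set \<Rightarrow> ('h \<Rightarrow>\<^sub>L 'h) monoid"
  where "unitary_group A = \<lparr>carrier = unitaries A, mult = (o\<^sub>L), one = unit_of A\<rparr>"

definition cstar_normalizer ::
    "('h::complex_hilbert_space \<Rightarrow>\<^sub>L 'h) set \<Rightarrow> ('h \<Rightarrow>\<^sub>L 'h) set \<Rightarrow> ('h \<Rightarrow>\<^sub>L 'h) set"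
  where "cstar_normalizer A B = {u \<in> unitaries B. (\<lambda>a. u o\<^sub>L a o\<^sub>L cadjoint u) ` A = A}"

definition crossed_product_like_by ::
    "('h::complex_hilbert_space \<Rightarrow>\<^sub>L 'h) set \<Rightarrow> ('h \<Rightarrow>\<^sub>L 'h) set \<Rightarrow> ('h \<Rightarrow>\<^sub>L 'h) set \<Rightarrow> bool"
  where "crossed_product_like_by A B U \<longleftrightarrow>
    unital_inclusion A B \<and> subgroup U (unitary_group B) \<and> U \<subseteq> cstar_normalizer A B \<and>
    B = cstar_subalgebra hull (A \<union> U)"

text \<open>
  Amenability of a discrete group: a left-invariant mean on the bounded real-valued functions.
  Functions are total on the ambient type; by positivity and additivity the mean depends only on
  the values on the carrier.
\<close>

definition amenable_group :: "('a, 'b) monoid_scheme \<Rightarrow> bool"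
  where "amenable_group G \<longleftrightarrow> group G \<and>
    (\<exists>m :: ('a \<Rightarrow> real) \<Rightarrow> real.
      (\<forall>f g. bounded (f ` carrier G) \<and> bounded (g ` carrier G) \<longrightarrow>
        m (\<lambda>x. f x + g x) = m f + m g) \<and>
      (\<forall>c f. bounded (f ` carrier G) \<longrightarrow> m (\<lambda>x. c * f x) = c * m f) \<and>
      (\<forall>f. bounded (f ` carrier G) \<and> (\<forall>x\<in>carrier G. 0 \<le> f x) \<longrightarrow> 0 \<le> m f) \<and>
      m (\<lambda>x. 1) = 1 \<and>
      (\<forall>f. \<forall>s\<in>carrier G. bounded (f ` carrier G) \<longrightarrow> m (\<lambda>x. f (s \<otimes>\<^bsub>G\<^esub> x)) = m f))"

definition crossed_product_like_amenable ::
    "('h::complex_hilbert_space \<Rightarrow>\<^sub>L 'h) set \<Rightarrow> ('h \<Rightarrow>\<^sub>L 'h) set \<Rightarrow> bool"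
  where "crossed_product_like_amenable A B \<longleftrightarrow>
    (\<exists>U. crossed_product_like_by A B U \<and> amenable_group ((unitary_group B)\<lparr>carrier := U\<rparr>))"

text \<open>
  A conditional expectation is a positive linear \<open>B\<close>-bimodule projection of \<open>D\<close> onto \<open>B\<close>;
  contractivity and complete positivity are consequences and not part of the definition.
\<close>

definition conditional_expectation ::
    "(('h::complex_hilbert_space \<Rightarrow>\<^sub>L 'h) \<Rightarrow> ('h \<Rightarrow>\<^sub>L 'h)) \<Rightarrow>
     ('h \<Rightarrow>\<^sub>L 'h) set \<Rightarrow> ('h \<Rightarrow>\<^sub>L 'h) set \<Rightarrow> bool"
  where "conditional_expectation E D B \<longleftrightarrow>
    (\<forall>x\<in>D. \<forall>y\<in>D. E (x + y) = E x + E y) \<and>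
    (\<forall>z. \<forall>x\<in>D. E (scaleC_op z x) = scaleC_op z (E x)) \<and>
    E ` D \<subseteq> B \<and> (\<forall>b\<in>B. E b = b) \<and>
    (\<forall>x\<in>D. positive_op x \<longrightarrow> positive_op (E x)) \<and>
    (\<forall>x\<in>D. \<forall>b\<in>B. \<forall>b'\<in>B. E (b o\<^sub>L x o\<^sub>L b') = b o\<^sub>L E x o\<^sub>L b')"

end

theory Submission
  imports Defs
begin

text \<open>
  The expectation \<open>E\<close> of \<open>D\<close> onto \<open>B\<close> detects membership in \<open>B\<close>, and irreducibility leaves it almost
  no freedom on a unitary \<open>u \<in> U\<close>. As \<open>E\<close> is a \<open>C\<close>-bimodule map and \<open>u\<close> normalizes \<open>C\<close>,
  \[ E(u) c = E(u c) = E(u c u^* u) = u c u^* E(u) \qquad (c \in C), \]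
  so \<open>u\<^sup>* E(u)\<close> commutes with \<open>C\<close> and is a scalar: \<open>E(u) = z u\<close>
  (\<open>expectation_normalizer_scalar\<close>). If \<open>z \<noteq> 0\<close>, then \<open>u = (1 / z) E(u)\<close> lies in \<open>B\<close>. The same
  applies to \<open>u\<^sup>*\<close>, so it is enough that \<open>E\<close> does not kill both \<open>u\<close> and \<open>u\<^sup>*\<close>. It cannot, because
  \<open>u\<close> is at distance less than \<open>1\<close> from some \<open>b \<in> B\<close>, which \<open>E\<close> fixes; this is a Kadison--Schwarz
  argument (\<open>expectation_near_unitary_nonzero\<close>).

  Thus \<open>C \<union> U \<subseteq> B\<close> and so \<open>A \<subseteq> B\<close>. A proper closed subspace of \<open>B\<close> stays far from some unit
  vector of \<open>B\<close>, so the small distance forces equality (\<open>closed_subspace_eq_if_near\<close>).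

  Positivity of a concrete operator is checked on vectors, which requires \<open>cadjoint\<close> to satisfy the
  adjoint identity; this rests on the Riesz representation theorem, obtained here by minimisation.
\<close>

section \<open>Inner products and adjoints\<close>

lemma cinner_add_right: "cinner x (y + z) = cinner x y + cinner x (z :: 'h::complex_hilbert_space)"
  by (metis cinner_add_left cinner_commute complex_cnj_add)

lemma cinner_scaleC_right: "cinner x (z *\<^sub>C y) = cnj z * cinner x (y :: 'h::complex_hilbert_space)"
  by (metis cinner_scaleC_left cinner_commute complex_cnj_mult)

lemma cinner_scaleR_left:
  "cinner (r *\<^sub>R x) y = complex_of_real r * cinner x (y :: 'h::complex_hilbert_space)"
  by (metis scaleC_of_real cinner_scaleC_left)

lemma cinner_scaleR_right:
  "cinner x (r *\<^sub>R y) = complex_of_real r * cinner x (y :: 'h::complex_hilbert_space)"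
  by (metis scaleC_of_real cinner_scaleC_right complex_cnj_complex_of_real)

lemma cinner_minus_left: "cinner (- x) y = - cinner x (y :: 'h::complex_hilbert_space)"
  using cinner_scaleR_left[of "-1" x y] by simp

lemma cinner_minus_right: "cinner x (- y) = - cinner x (y :: 'h::complex_hilbert_space)"
  using cinner_scaleR_right[of x "-1" y] by simp

lemma cinner_diff_left: "cinner (x - y) z = cinner x z - cinner y (z :: 'h::complex_hilbert_space)"
  using cinner_add_left[of x "- y" z] by (simp add: cinner_minus_left)

lemma cinner_diff_right: "cinner x (y - z) = cinner x y - cinner x (z :: 'h::complex_hilbert_space)"
  using cinner_add_right[of x y "- z"] by (simp add: cinner_minus_right)

lemma Re_cinner_commute: "Re (cinner x y) = Re (cinner y (x :: 'h::complex_hilbert_space))"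
  by (metis cinner_commute complex_cnj(1) complex.sel(1) complex_surj)

lemma Re_cinner_self: "Re (cinner x x) = (norm (x :: 'h::complex_hilbert_space))\<^sup>2"
  by (simp add: cinner_self)

lemma norm_add_squared:
  "(norm (x + y :: 'h::complex_hilbert_space))\<^sup>2 = (norm x)\<^sup>2 + 2 * Re (cinner x y) + (norm y)\<^sup>2"
  using Re_cinner_commute[of x y]
  by (simp add: cinner_add_left cinner_add_right flip: Re_cinner_self)

lemma norm_diff_squared:
  "(norm (x - y :: 'h::complex_hilbert_space))\<^sup>2 = (norm x)\<^sup>2 - 2 * Re (cinner x y) + (norm y)\<^sup>2"
  using norm_add_squared[of x "- y"] by (simp add: cinner_minus_right)

text \<open>
  Since the norm is already known to satisfy the triangle inequality, expanding the square of
  \<open>norm (x + y) \<le> norm x + norm y\<close> gives the Cauchy--Schwarz inequality at once.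
\<close>

lemma Re_cinner_le: "Re (cinner x y) \<le> norm x * norm (y :: 'h::complex_hilbert_space)"
proof -
  have "(norm (x + y))\<^sup>2 \<le> (norm x + norm y)\<^sup>2"
    by (intro power_mono norm_triangle_ineq norm_ge_zero)
  then show ?thesis
    unfolding norm_add_squared power2_sum by simp
qed

lemma abs_Re_cinner_le: "\<bar>Re (cinner x y)\<bar> \<le> norm x * norm (y :: 'h::complex_hilbert_space)"
  using Re_cinner_le[of x y] Re_cinner_le[of "- x" y] by (simp add: cinner_minus_left abs_le_iff)

lemma cinner_eqI:
  fixes s t :: "'h::complex_hilbert_space"
  assumes "\<And>x. Re (cinner x s) = Re (cinner x t)"
  shows "s = t"
proof -
  have "Re (cinner (s - t) (s - t)) = 0"
    unfolding cinner_diff_right using assms[of "s - t"] by simp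
  then show ?thesis
    by (simp add: Re_cinner_self)
qed

text \<open>
  The Riesz representation theorem, in its real form. The representing vector is the minimiser of
  \<open>J x = (norm x)\<^sup>2 - 2 * f x\<close>: by the parallelogram law minimising sequences are Cauchy, and the
  first variation of \<open>J\<close> vanishes at the minimum.
\<close>

lemma riesz_representation_real:
  fixes f :: "'h::complex_hilbert_space \<Rightarrow> real"
  assumes f: "bounded_linear f"
  shows "\<exists>s. \<forall>x. f x = Re (cinner x s)"
proof -
  interpret f: bounded_linear f by (rule f)
  obtain K where K: "\<And>x. norm (f x) \<le> norm x * K"
    using f.bounded by blast
  define J where "J x = (norm x)\<^sup>2 - 2 * f x" for x
  have J_ge: "- K\<^sup>2 \<le> J x" for x
  proof -
    have "f x \<le> norm x * K" using K[of x] by simp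
    moreover have "0 \<le> (norm x - K)\<^sup>2" by simp
    ultimately show ?thesis unfolding J_def power2_diff by simp
  qed
  define m where "m = Inf (range J)"
  have bdd: "bdd_below (range J)" using J_ge by (intro bdd_belowI2)
  have m_le: "m \<le> J x" for x
    unfolding m_def by (rule cInf_lower) (use bdd in auto)
  have "\<exists>x. J x < m + inverse (real (Suc n))" for n
    using cInf_lessD[of "range J" "m + inverse (real (Suc n))"] by (auto simp: m_def)
  then obtain X where X: "\<And>n. J (X n) < m + inverse (real (Suc n))" by metis
  have gap: "(norm (x - y))\<^sup>2 \<le> 2 * (J x - m) + 2 * (J y - m)" for x y
  proof -
    have "J ((1/2) *\<^sub>R (x + y)) = (1/4) * (norm (x + y))\<^sup>2 - f x - f y"
      unfolding J_def f.scaleR f.add norm_scaleR power_mult_distrib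
      by (simp add: power2_eq_square field_simps)
    then have "m \<le> (1/4) * (norm (x + y))\<^sup>2 - f x - f y"
      using m_le[of "(1/2) *\<^sub>R (x + y)"] by simp
    then show ?thesis
      unfolding J_def norm_add_squared norm_diff_squared by (simp add: field_simps)
  qed
  have "Cauchy X"
  proof (rule metric_CauchyI)
    fix e :: real assume "0 < e"
    then obtain N where N: "inverse (real (Suc N)) < e\<^sup>2 / 4"
      using reals_Archimedean[of "e\<^sup>2 / 4"] by auto
    have near_min: "J (X k) < m + e\<^sup>2 / 4" if "N \<le> k" for k
    proof -
      have "J (X k) < m + inverse (real (Suc k))" by (rule X)
      also have "\<dots> \<le> m + inverse (real (Suc N))"
        using that by (intro add_left_mono le_imp_inverse_le) auto
      also have "\<dots> < m + e\<^sup>2 / 4" using N by (rule add_strict_left_mono)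
      finally show ?thesis .
    qed
    show "\<exists>M. \<forall>i\<ge>M. \<forall>j\<ge>M. dist (X i) (X j) < e"
    proof (intro exI[of _ N] allI impI)
      fix i j assume "N \<le> i" "N \<le> j"
      with gap[of "X i" "X j"] near_min[of i] near_min[of j]
      have "(norm (X i - X j))\<^sup>2 < e\<^sup>2" by simp
      then show "dist (X i) (X j) < e"
        using \<open>0 < e\<close> by (simp add: dist_norm power2_less_imp_less)
    qed
  qed
  then obtain s where s: "X \<longlonglongrightarrow> s"
    using Cauchy_convergent convergent_def by blast
  have "(\<lambda>n. J (X n)) \<longlonglongrightarrow> J s"
    unfolding J_def by (intro tendsto_intros s f.tendsto)
  moreover have "(\<lambda>n. m + inverse (real (Suc n))) \<longlonglongrightarrow> m"
    using tendsto_add[OF tendsto_const LIMSEQ_inverse_real_of_nat, of m] by simp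
  ultimately have "J s \<le> m"
    by (rule LIMSEQ_le) (use X less_imp_le in blast)
  then have min: "J s \<le> J x" for x using m_le[of x] by linarith
  have "f x = Re (cinner x s)" for x
  proof -
    define c where "c = Re (cinner x s) - f x"
    have quad: "0 \<le> r\<^sup>2 * (norm x)\<^sup>2 + 2 * r * c" for r
      using min[of "s + r *\<^sub>R x"] Re_cinner_commute[of s x]
      unfolding J_def norm_add_squared
      by (simp add: f.add f.scaleR cinner_scaleR_right c_def algebra_simps)
    \<comment> \<open>The quadratic polynomial in \<open>r\<close> is nonnegative and vanishes at \<open>0\<close>; this \<open>r\<close> would make
        it negative.\<close>
    define r where "r = - c / ((norm x)\<^sup>2 + 1)"
    have pos: "(norm x)\<^sup>2 + 1 > 0" by (simp add: add_nonneg_pos)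
    have "r * ((norm x)\<^sup>2 + 1) = - c"
      using pos by (simp add: r_def)
    then have c: "c = - (r * ((norm x)\<^sup>2 + 1))" by simp
    have neg: "0 \<le> - (r\<^sup>2 * ((norm x)\<^sup>2 + 2))"
      using quad[of r] unfolding c by (simp add: algebra_simps power2_eq_square)
    have "r = 0"
    proof (rule ccontr)
      assume "r \<noteq> 0"
      then have "0 < r\<^sup>2 * ((norm x)\<^sup>2 + 2)"
        by (intro mult_pos_pos) (simp_all add: add_nonneg_pos)
      with neg show False by linarith
    qed
    with c show ?thesis by (simp add: c_def)
  qed
  then show ?thesis by blast
qed

text \<open>
  A complex-linear functional is determined by its real part, through
  \<open>Im w = - Re (\<i> * w)\<close>; hence the real form of the Riesz theorem yields complex adjoints.
\<close>

lemma adjoint_exists: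
  fixes T :: "'h::complex_hilbert_space \<Rightarrow>\<^sub>L 'h"
  assumes T: "T \<in> bounded_operators"
  shows "\<exists>S :: 'h \<Rightarrow>\<^sub>L 'h. \<forall>x y. cinner (T x) y = cinner x (S y)"
proof -
  have "\<exists>s. \<forall>x. Re (cinner (T x) y) = Re (cinner x s)" for y
  proof (rule riesz_representation_real, rule bounded_linear_intro)
    show "norm (Re (cinner (T x) y)) \<le> norm x * (norm T * norm y)" for x
    proof -
      have "norm (Re (cinner (T x) y)) \<le> norm (T x) * norm y"
        using abs_Re_cinner_le by simp
      also have "\<dots> \<le> (norm T * norm x) * norm y"
        by (intro mult_right_mono norm_blinfun) simp
      finally show ?thesis by (simp add: algebra_simps)
    qed
  qed (simp_all add: blinfun.add_right blinfun.scaleR_right cinner_add_left cinner_scaleR_left)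
  then obtain S where S: "\<And>x y. Re (cinner (T x) y) = Re (cinner x (S y))" by metis
  have "bounded_linear S"
  proof (rule bounded_linear_intro)
    show "S (y + z) = S y + S z" for y z
      by (rule cinner_eqI) (simp add: cinner_add_right flip: S)
    show "S (r *\<^sub>R y) = r *\<^sub>R S y" for r y
      by (rule cinner_eqI) (simp add: cinner_scaleR_right flip: S)
    show "norm (S y) \<le> norm y * norm T" for y
    proof -
      have "norm (S y) * norm (S y) = Re (cinner (T (S y)) y)"
        unfolding S Re_cinner_self by (simp add: power2_eq_square)
      also have "\<dots> \<le> norm (T (S y)) * norm y" by (rule Re_cinner_le)
      also have "\<dots> \<le> (norm T * norm (S y)) * norm y"
        by (intro mult_right_mono norm_blinfun) simp
      finally have "norm (S y) * norm (S y) \<le> norm (S y) * (norm y * norm T)"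
        by (simp add: algebra_simps)
      then show ?thesis
        by (cases "norm (S y) = 0") (simp_all add: mult_le_cancel_left)
    qed
  qed
  then have app: "blinfun_apply (Blinfun S) = S" by (rule bounded_linear_Blinfun_apply)
  have "cinner (T x) y = cinner x (S y)" for x y
  proof (rule complex_eqI[OF S])
    have "T (\<i> *\<^sub>C x) = \<i> *\<^sub>C T x" using T by (simp add: bounded_operators_def)
    then show "Im (cinner (T x) y) = Im (cinner x (S y))"
      using S[of "\<i> *\<^sub>C x" y] by (simp add: cinner_scaleC_left)
  qed
  with app show ?thesis by (intro exI[of _ "Blinfun S"]) simp
qed

lemma cadjoint_eqI:
  fixes S T :: "'h::complex_hilbert_space \<Rightarrow>\<^sub>L 'h"
  assumes "\<And>x y. cinner (T x) y = cinner x (S y)"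
  shows "cadjoint T = S"
  unfolding cadjoint_def
proof (rule the_equality)
  fix S' :: "'h \<Rightarrow>\<^sub>L 'h"
  assume "\<forall>x y. cinner (T x) y = cinner x (S' y)"
  then show "S' = S"
    by (intro blinfun_eqI cinner_eqI) (simp flip: assms)
qed (use assms in blast)

lemma cinner_cadjoint_right:
  fixes T :: "'h::complex_hilbert_space \<Rightarrow>\<^sub>L 'h"
  assumes "T \<in> bounded_operators"
  shows "cinner x (cadjoint T y) = cinner (T x) y"
  using adjoint_exists[OF assms] cadjoint_eqI[of T] by metis

lemma cinner_cadjoint_left:
  fixes T :: "'h::complex_hilbert_space \<Rightarrow>\<^sub>L 'h"
  assumes "T \<in> bounded_operators"
  shows "cinner (cadjoint T x) y = cinner x (T y)"
  using cinner_cadjoint_right[OF assms, of y x] by (metis cinner_commute)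

lemma cadjoint_cadjoint:
  fixes T :: "'h::complex_hilbert_space \<Rightarrow>\<^sub>L 'h"
  assumes "T \<in> bounded_operators"
  shows "cadjoint (cadjoint T) = T"
  by (rule cadjoint_eqI) (rule cinner_cadjoint_left[OF assms])

section \<open>Subalgebras and their units\<close>

lemma blinfun_compose_assoc: "(R o\<^sub>L S) o\<^sub>L T = R o\<^sub>L (S o\<^sub>L T)"
  by (rule blinfun_eqI) simp

lemma scaleC_op_of_real: "scaleC_op (complex_of_real r) T = r *\<^sub>R T"
  by (rule blinfun_eqI) (simp add: scaleC_op.rep_eq scaleC_of_real blinfun.scaleR_left)

lemma cstar_subalgebra_scaleR: "cstar_subalgebra A \<Longrightarrow> T \<in> A \<Longrightarrow> r *\<^sub>R T \<in> A"
  by (metis cstar_subalgebra_def scaleC_op_of_real)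

lemma cstar_subalgebra_diff: "cstar_subalgebra A \<Longrightarrow> S \<in> A \<Longrightarrow> T \<in> A \<Longrightarrow> S - T \<in> A"
  using cstar_subalgebra_scaleR[of A T "-1"] unfolding cstar_subalgebra_def
  by (metis diff_conv_add_uminus scaleR_minus1_left)

lemma unit_of_eq:
  assumes "is_unit_of e A"
  shows "unit_of A = e"
  unfolding unit_of_def
proof (rule the_equality)
  fix f assume "is_unit_of f A"
  with assms show "f = e" unfolding is_unit_of_def by metis
qed (rule assms)

text \<open>
  A unit \<open>e\<close> of a self-adjoint algebra is a projection: \<open>e\<^sup>* = e\<^sup>* e\<close>, and the right-hand side is
  self-adjoint.
\<close>

lemma cinner_unit:
  fixes e :: "'h::complex_hilbert_space \<Rightarrow>\<^sub>L 'h"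
  assumes A: "cstar_subalgebra A" and e: "is_unit_of e A"
  shows "cinner (e x) x = complex_of_real ((norm (e x))\<^sup>2)"
proof -
  have eb: "e \<in> bounded_operators" and ea: "cadjoint e \<in> A" "e \<in> A"
    using A e unfolding cstar_subalgebra_def is_unit_of_def by auto
  have "cadjoint e o\<^sub>L e = cadjoint e"
    using e ea unfolding is_unit_of_def by blast
  then have ee: "cadjoint e (e y) = cadjoint e y" for y
    by (metis blinfun_apply_blinfun_compose)
  have "cinner (e x) x = cinner x (cadjoint e x)" by (simp add: cinner_cadjoint_right[OF eb])
  also have "\<dots> = cinner x (cadjoint e (e x))" by (simp add: ee)
  also have "\<dots> = cinner (e x) (e x)" by (rule cinner_cadjoint_right[OF eb])
  finally show ?thesis by (simp add: cinner_self)
qed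

lemma norm_unit_le:
  fixes e :: "'h::complex_hilbert_space \<Rightarrow>\<^sub>L 'h"
  assumes "cstar_subalgebra A" and "is_unit_of e A"
  shows "norm (e x) \<le> norm x"
proof -
  have "norm (e x) * norm (e x) \<le> norm (e x) * norm x"
    using Re_cinner_le[of "e x" x] cinner_unit[OF assms, of x] by (simp add: power2_eq_square)
  then show ?thesis
    by (cases "norm (e x) = 0") (simp_all add: mult_le_cancel_left)
qed

lemma norm_isometry_le:
  fixes u :: "'h::complex_hilbert_space \<Rightarrow>\<^sub>L 'h"
  assumes A: "cstar_subalgebra A" and e: "is_unit_of e A"
    and u: "u \<in> A" and uu: "cadjoint u o\<^sub>L u = e"
  shows "norm u \<le> 1"
proof (rule norm_blinfun_bound)
  fix x
  have "u \<in> bounded_operators" using A u unfolding cstar_subalgebra_def by blast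
  then have "cinner (u x) (u x) = cinner (cadjoint u (u x)) x"
    by (simp add: cinner_cadjoint_left)
  also have "cadjoint u (u x) = e x" by (simp flip: uu)
  finally have "(norm (u x))\<^sup>2 = (norm (e x))\<^sup>2"
    unfolding cinner_unit[OF A e] cinner_self of_real_eq_iff .
  then show "norm (u x) \<le> 1 * norm x"
    using norm_unit_le[OF A e, of x] by simp
qed simp

section \<open>Near inclusions\<close>

text \<open>
  A real supremum bounds its members only over a set that is bounded above; here the competitor
  \<open>b = 0\<close> bounds every infimum by \<open>1\<close>.
\<close>

lemma near_inclusion:
  assumes A: "0 \<in> A" and B: "0 \<in> B" and a: "a \<in> unit_ball A"
    and lt: "(SUP a\<in>unit_ball A. INF b\<in>unit_ball B. norm (a - b)) < r"
  obtains b where "b \<in> B" "norm (a - b) < r"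
proof -
  have B0: "0 \<in> unit_ball B" using B by (simp add: unit_ball_def)
  have bdd: "bdd_below ((\<lambda>b. norm (x - b)) ` unit_ball B)" for x
    by (rule bdd_belowI2[where m = 0]) simp
  have "(INF b\<in>unit_ball B. norm (x - b)) \<le> 1" if "x \<in> unit_ball A" for x
    using cINF_lower[OF bdd B0, of x] that by (simp add: unit_ball_def)
  then have "bdd_above ((\<lambda>a. INF b\<in>unit_ball B. norm (a - b)) ` unit_ball A)"
    by (intro bdd_aboveI2)
  from cSUP_upper[OF a this] lt have "(INF b\<in>unit_ball B. norm (a - b)) < r"
    by simp
  then obtain b where "b \<in> unit_ball B" "norm (a - b) < r"
    using B0 by (subst (asm) cINF_less_iff[OF _ bdd]) auto
  with that show thesis by (auto simp: unit_ball_def)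
qed

text \<open>
  Riesz's lemma: if \<open>x \<in> B\<close> has distance \<open>d > 0\<close> from \<open>A\<close> and \<open>a \<in> A\<close> satisfies
  \<open>norm (x - a) < 2 * d\<close>, then normalising \<open>x - a\<close> gives a unit vector of \<open>B\<close> whose distance from
  \<open>A\<close> exceeds \<open>1 / 2\<close>.
\<close>

lemma closed_subspace_eq_if_near:
  fixes A B :: "'a::real_normed_vector set"
  assumes A: "subspace A" "closed A" and B: "subspace B" and "A \<subseteq> B"
    and near: "\<And>x. x \<in> B \<Longrightarrow> norm x \<le> 1 \<Longrightarrow> \<exists>a\<in>A. norm (x - a) < 1 / 2"
  shows "A = B"
proof (rule ccontr)
  assume "A \<noteq> B"
  with \<open>A \<subseteq> B\<close> obtain x where x: "x \<in> B" "x \<notin> A" by blast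
  have ne: "A \<noteq> {}" using A subspace_0 by blast
  define d where "d = infdist x A"
  have d: "0 < d"
    using x(2) in_closed_iff_infdist_zero[OF A(2) ne, of x] infdist_nonneg[of x A]
    unfolding d_def by linarith
  have "infdist x A < 2 * d" using d by (simp add: d_def)
  then have "\<exists>a\<in>A. dist x a < 2 * d"
    unfolding infdist_notempty[OF ne] by (subst (asm) cINF_less_iff) (use ne in auto)
  then obtain a where a: "a \<in> A" "norm (x - a) < 2 * d" by (auto simp: dist_norm)
  define n where "n = norm (x - a)"
  have n: "0 < n" using a(1) x(2) by (auto simp: n_def)
  have "(1 / n) *\<^sub>R (x - a) \<in> B"
    using B x(1) a(1) \<open>A \<subseteq> B\<close> by (intro subspace_scale subspace_diff) auto
  moreover have "norm ((1 / n) *\<^sub>R (x - a)) \<le> 1" using n by (simp add: n_def)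
  ultimately obtain a' where a': "a' \<in> A" "norm ((1 / n) *\<^sub>R (x - a) - a') < 1 / 2"
    using near by blast
  have "x - (a + n *\<^sub>R a') = n *\<^sub>R ((1 / n) *\<^sub>R (x - a) - a')"
    using n by (simp add: algebra_simps)
  then have "dist x (a + n *\<^sub>R a') = n * norm ((1 / n) *\<^sub>R (x - a) - a')"
    using n by (simp add: dist_norm)
  also have "\<dots> < n * (1 / 2)" using n a'(2) by (rule mult_strict_left_mono[rotated])
  also have "\<dots> < d" using a(2) by (simp add: n_def)
  finally have "dist x (a + n *\<^sub>R a') < d" .
  moreover have "a + n *\<^sub>R a' \<in> A"
    using A(1) a(1) a'(1) by (intro subspace_add subspace_scale)
  ultimately show False
    using infdist_le[of "a + n *\<^sub>R a'" A x] by (simp add: d_def)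
qed

lemma cstar_subalgebra_subspace: "cstar_subalgebra A \<Longrightarrow> subspace A"
  by (rule subspaceI) (auto simp: cstar_subalgebra_scaleR, auto simp: cstar_subalgebra_def)

section \<open>Expectations of normalizing unitaries\<close>

text \<open>
  Moving \<open>c\<close> through \<open>v\<close> replaces it by \<open>v c w\<close>, an element of \<open>C\<close>, and \<open>E\<close> is \<open>C\<close>-bimodular, so
  \<open>E v\<close> implements the same automorphism of \<open>C\<close> as \<open>v\<close>. Therefore \<open>w E(v)\<close> commutes with \<open>C\<close>, and
  irreducibility makes it a scalar.
\<close>

lemma expectation_normalizer_scalar:
  fixes v w :: "'h::complex_hilbert_space \<Rightarrow>\<^sub>L 'h"
  assumes irr: "irreducible_inclusion C D"
    and C: "is_unit_of e D" "e \<in> C" "C \<subseteq> B" "B \<subseteq> D"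
    and E: "conditional_expectation E D B"
    and v: "v \<in> D" and w: "w \<in> D" and vw: "v o\<^sub>L w = e" and wv: "w o\<^sub>L v = e"
    and norm: "\<And>c. c \<in> C \<Longrightarrow> v o\<^sub>L c o\<^sub>L w \<in> C"
  shows "\<exists>z. E v = scaleC_op z v"
proof -
  note assoc = blinfun_compose_assoc
  have D: "S o\<^sub>L T \<in> D" if "S \<in> D" "T \<in> D" for S T
    using irr that unfolding irreducible_inclusion_def unital_inclusion_def cstar_subalgebra_def
    by blast
  have eD: "e o\<^sub>L T = T" "T o\<^sub>L e = T" if "T \<in> D" for T
    using C(1) that unfolding is_unit_of_def by auto
  have EB: "E v \<in> D" using E v C(4) unfolding conditional_expectation_def by blast
  have bim: "E (b o\<^sub>L v o\<^sub>L b') = b o\<^sub>L E v o\<^sub>L b'" if "b \<in> C" "b' \<in> C" for b b'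
    using E v that C(3) unfolding conditional_expectation_def by blast
  have "(w o\<^sub>L E v) o\<^sub>L c = c o\<^sub>L (w o\<^sub>L E v)" if c: "c \<in> C" for c
  proof -
    have cD: "c \<in> D" using c C by blast
    let ?c = "v o\<^sub>L c o\<^sub>L w"
    have "E v o\<^sub>L c = e o\<^sub>L E v o\<^sub>L c" by (simp add: eD EB)
    also have "\<dots> = E (e o\<^sub>L v o\<^sub>L c)" using bim[OF C(2) c] by simp
    also have "e o\<^sub>L v o\<^sub>L c = ?c o\<^sub>L v o\<^sub>L e" by (simp add: eD v cD D assoc wv)
    also have "E (?c o\<^sub>L v o\<^sub>L e) = ?c o\<^sub>L E v o\<^sub>L e" by (rule bim[OF norm[OF c] C(2)])
    finally have "E v o\<^sub>L c = ?c o\<^sub>L E v" by (simp add: eD EB assoc)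
    then have "(w o\<^sub>L E v) o\<^sub>L c = w o\<^sub>L (?c o\<^sub>L E v)" by (simp add: assoc)
    also have "\<dots> = (w o\<^sub>L v) o\<^sub>L c o\<^sub>L (w o\<^sub>L E v)" by (simp add: assoc)
    finally show ?thesis by (simp add: wv eD cD)
  qed
  then have "w o\<^sub>L E v \<in> relative_commutant C D"
    unfolding relative_commutant_def using D w EB by blast
  then obtain z where z: "w o\<^sub>L E v = scaleC_op z e"
    using irr unit_of_eq[OF C(1)] unfolding irreducible_inclusion_def by auto
  have vb: "v \<in> bounded_operators"
    using irr v unfolding irreducible_inclusion_def unital_inclusion_def cstar_subalgebra_def
    by blast
  have "E v = (v o\<^sub>L w) o\<^sub>L E v" by (simp add: vw eD EB)
  also have "\<dots> = v o\<^sub>L scaleC_op z e" by (simp add: assoc z)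
  also have "\<dots> = scaleC_op z (v o\<^sub>L e)"
    using vb by (intro blinfun_eqI) (simp add: scaleC_op.rep_eq bounded_operators_def)
  finally show ?thesis by (auto simp: eD v)
qed

text \<open>
  The Kadison--Schwarz inequality in the form required: if \<open>E\<close> killed \<open>u\<close> and \<open>u\<^sup>*\<close>, then applying
  it to the positive operator \<open>t e - (u - b)\<^sup>* (u - b)\<close> with \<open>t = (norm (u - b))\<^sup>2 < 1\<close> would leave
  \<open>(t - 1) e - b\<^sup>* b\<close>, which is positive only if \<open>e = 0\<close>.
\<close>

lemma expectation_near_unitary_nonzero:
  fixes u b :: "'h::complex_hilbert_space \<Rightarrow>\<^sub>L 'h"
  assumes D: "cstar_subalgebra D" and B: "cstar_subalgebra B" "B \<subseteq> D"
    and e: "is_unit_of e D" "e \<in> B" "e \<noteq> 0"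
    and E: "conditional_expectation E D B"
    and u: "u \<in> D" "cadjoint u o\<^sub>L u = e"
    and b: "b \<in> B" "norm (u - b) < 1"
  shows "E u \<noteq> 0 \<or> E (cadjoint u) \<noteq> 0"
proof (rule ccontr)
  assume "\<not> ?thesis"
  then have E0: "E u = 0" "E (cadjoint u) = 0" by auto
  let ?u = "cadjoint u" and ?b = "cadjoint b"
  define t where "t = (norm (u - b))\<^sup>2"
  have t: "t < 1" using b(2) unfolding t_def by (simp add: power_less_one_iff abs_square_less_1)
  have mem: "u \<in> D" "?u \<in> D" "b \<in> D" "?b \<in> D" "?b \<in> B" "e \<in> D"
    using D B u b e unfolding cstar_subalgebra_def by auto
  have bo: "u \<in> bounded_operators" "b \<in> bounded_operators"
    using mem D unfolding cstar_subalgebra_def by auto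
  have eD: "e o\<^sub>L T = T" "T o\<^sub>L e = T" if "T \<in> D" for T
    using e(1) that unfolding is_unit_of_def by auto
  have comp: "S o\<^sub>L T \<in> D" if "S \<in> D" "T \<in> D" for S T
    using D that unfolding cstar_subalgebra_def by blast
  have add: "S + T \<in> D" if "S \<in> D" "T \<in> D" for S T
    using D that unfolding cstar_subalgebra_def by blast
  note diff = cstar_subalgebra_diff[OF D] and scale = cstar_subalgebra_scaleR[OF D]
  have E_add: "E (S + T) = E S + E T" if "S \<in> D" "T \<in> D" for S T
    using E that unfolding conditional_expectation_def by blast
  have E_scale: "E (r *\<^sub>R T) = r *\<^sub>R E T" if "T \<in> D" for r T
    using E that unfolding conditional_expectation_def by (metis scaleC_op_of_real)
  have E_diff: "E (S - T) = E S - E T" if "S \<in> D" "T \<in> D" for S T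
    using E_add[of "S - T" T] that diff by simp
  have bim: "E (S o\<^sub>L T o\<^sub>L S') = S o\<^sub>L E T o\<^sub>L S'" if "T \<in> D" "S \<in> B" "S' \<in> B" for S S' T
    using E that unfolding conditional_expectation_def by blast
  have E_id: "E T = T" if "T \<in> B" for T
    using E that unfolding conditional_expectation_def by blast
  define P where "P = t *\<^sub>R e - ((?u - ?b) o\<^sub>L (u - b))"
  have P: "P \<in> D" unfolding P_def by (intro diff comp scale mem)
  have "positive_op P"
    unfolding positive_op_def
  proof
    fix x
    have eq: "(u - b) o\<^sub>L e = u - b" by (rule eD(2)) (intro diff mem)
    have "(u - b) x = (u - b) (e x)"
      by (metis eq blinfun_apply_blinfun_compose)
    then have "norm ((u - b) x) \<le> norm (u - b) * norm (e x)"
      by (metis norm_blinfun)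
    then have le: "(norm ((u - b) x))\<^sup>2 \<le> t * (norm (e x))\<^sup>2"
      unfolding t_def by (metis power_mono norm_ge_zero power_mult_distrib)
    have "cinner ((?u - ?b) ((u - b) x)) x = cinner ((u - b) x) ((u - b) x)"
      by (simp add: blinfun.diff_left cinner_diff_left cinner_diff_right
          cinner_cadjoint_left[OF bo(1)] cinner_cadjoint_left[OF bo(2)])
    then have "cinner (P x) x = complex_of_real (t * (norm (e x))\<^sup>2 - (norm ((u - b) x))\<^sup>2)"
      by (simp add: P_def blinfun.diff_left blinfun.scaleR_left cinner_diff_left
          cinner_scaleR_left cinner_unit[OF D e(1)] cinner_self)
    also have "\<dots> \<in> \<real>\<^sub>\<ge>\<^sub>0"
      using le by (simp only: nonneg_Reals_of_real_iff diff_ge_0_iff_ge)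
    finally show "cinner (P x) x \<in> \<real>\<^sub>\<ge>\<^sub>0" .
  qed
  then have EP: "positive_op (E P)"
    using E P unfolding conditional_expectation_def by blast
  \<comment> \<open>The factors \<open>e\<close> put the mixed terms into the two-sided form to which bimodularity applies.\<close>
  have "P = (t - 1) *\<^sub>R e + (e o\<^sub>L ?u o\<^sub>L b) + (?b o\<^sub>L u o\<^sub>L e) - (?b o\<^sub>L b)"
    unfolding P_def
    by (simp add: eD mem comp bounded_bilinear.diff_left[OF bounded_bilinear_blinfun_compose]
        bounded_bilinear.diff_right[OF bounded_bilinear_blinfun_compose] u(2) scaleR_left_diff_distrib)
  moreover have "?b o\<^sub>L b \<in> B" using B(1) b(1) mem unfolding cstar_subalgebra_def by blast
  ultimately have "E P = (t - 1) *\<^sub>R e - (?b o\<^sub>L b)"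
    by (simp add: E_add E_diff E_scale E_id bim E0 e(2) b(1) mem comp add scale)
  then have val: "cinner (E P x) x = complex_of_real ((t - 1) * (norm (e x))\<^sup>2 - (norm (b x))\<^sup>2)" for x
    by (simp add: blinfun.diff_left blinfun.scaleR_left cinner_diff_left cinner_scaleR_left
        cinner_unit[OF D e(1)] cinner_cadjoint_left[OF bo(2)] cinner_self)
  have "e x = 0" for x
  proof -
    have "complex_of_real ((t - 1) * (norm (e x))\<^sup>2 - (norm (b x))\<^sup>2) \<in> \<real>\<^sub>\<ge>\<^sub>0"
      using EP val[of x] unfolding positive_op_def by metis
    then have "0 \<le> (t - 1) * (norm (e x))\<^sup>2 - (norm (b x))\<^sup>2"
      by (simp only: nonneg_Reals_of_real_iff)
    moreover have "0 \<le> (norm (b x))\<^sup>2" by simp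
    ultimately have "0 \<le> (t - 1) * (norm (e x))\<^sup>2" by linarith
    with t show ?thesis by (auto simp: zero_le_mult_iff)
  qed
  then have "e = 0" by (intro blinfun_eqI) simp
  with e(3) show False by simp
qed

lemma normalizer_in_image_of_expectation:
  fixes u b :: "'h::complex_hilbert_space \<Rightarrow>\<^sub>L 'h"
  assumes irr: "irreducible_inclusion C D"
    and e: "is_unit_of e D" "e \<in> C"
    and B: "cstar_subalgebra B" "C \<subseteq> B" "B \<subseteq> D"
    and E: "conditional_expectation E D B"
    and u: "u \<in> D" "cadjoint u o\<^sub>L u = e" "u o\<^sub>L cadjoint u = e"
    and norm: "(\<lambda>c. u o\<^sub>L c o\<^sub>L cadjoint u) ` C = C"
    and b: "b \<in> B" "norm (u - b) < 1"
  shows "u \<in> B"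
proof (cases "e = 0")
  case True
  have "u = e o\<^sub>L u" using e(1) u(1) unfolding is_unit_of_def by simp
  with True have "u = 0" by simp
  then show ?thesis using B(1) unfolding cstar_subalgebra_def by blast
next
  case False
  have D: "cstar_subalgebra D" "C \<subseteq> D"
    using irr unfolding irreducible_inclusion_def unital_inclusion_def by auto
  have us: "cadjoint u \<in> D" and ub: "u \<in> bounded_operators"
    using D u(1) unfolding cstar_subalgebra_def by auto
  have inB: "v \<in> B" if z: "E v = scaleC_op z v" and nz: "E v \<noteq> 0" and v: "v \<in> D" for v z
  proof -
    have "z \<noteq> 0"
    proof
      assume "z = 0"
      then have "E v = 0" using z scaleC_op_of_real[of 0 v] by simp
      with nz show False ..
    qed
    then have "scaleC_op (inverse z) (E v) = v"
      unfolding z using scaleC_of_real[of 1]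
      by (intro blinfun_eqI) (simp add: scaleC_op.rep_eq scaleC_scaleC)
    moreover have "E v \<in> B" using E v unfolding conditional_expectation_def by blast
    ultimately show ?thesis using B(1) unfolding cstar_subalgebra_def by metis
  qed
  have conj: "u o\<^sub>L c o\<^sub>L cadjoint u \<in> C" if "c \<in> C" for c
    using norm that by blast
  have conj': "cadjoint u o\<^sub>L c o\<^sub>L u \<in> C" if "c \<in> C" for c
  proof -
    have "c \<in> (\<lambda>c. u o\<^sub>L c o\<^sub>L cadjoint u) ` C" using that by (simp only: norm)
    then obtain c' where c': "c = u o\<^sub>L c' o\<^sub>L cadjoint u" "c' \<in> C" by (rule imageE)
    have "cadjoint u o\<^sub>L c o\<^sub>L u = (cadjoint u o\<^sub>L u) o\<^sub>L c' o\<^sub>L (cadjoint u o\<^sub>L u)"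
      unfolding c'(1) by (simp only: blinfun_compose_assoc)
    also have "\<dots> = c'" using e(1) D(2) c'(2) unfolding u(2) is_unit_of_def by auto
    finally show ?thesis using c'(2) by simp
  qed
  obtain z where z: "E u = scaleC_op z u"
    using expectation_normalizer_scalar[OF irr e B(2,3) E u(1) us u(3,2) conj] by blast
  obtain z' where z': "E (cadjoint u) = scaleC_op z' (cadjoint u)"
    using expectation_normalizer_scalar[OF irr e B(2,3) E us u(1) u(2,3) conj'] by blast
  have "e \<in> B" using e(2) B(2) by blast
  from expectation_near_unitary_nonzero[OF D(1) B(1,3) e(1) this False E u(1,2) b]
  show ?thesis
  proof
    assume "E u \<noteq> 0"
    then show ?thesis using inB z u(1) by blast
  next
    assume "E (cadjoint u) \<noteq> 0"
    then have "cadjoint u \<in> B" using inB z' us by blast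
    then have "cadjoint (cadjoint u) \<in> B" using B(1) unfolding cstar_subalgebra_def by blast
    then show ?thesis by (simp add: cadjoint_cadjoint[OF ub])
  qed
qed

theorem theorem1:
  fixes A B C D :: "('h::complex_hilbert_space \<Rightarrow>\<^sub>L 'h) set"
  assumes "separable_space (euclidean :: 'h topology)"
    and "irreducible_inclusion C D"
    and "cstar_subalgebra A" and "C \<subseteq> A" and "A \<subseteq> D"
    and "cstar_subalgebra B" and "C \<subseteq> B" and "B \<subseteq> D"
    and "separable_space (top_of_set A)" and "separable_space (top_of_set B)"
    and "\<exists>E. conditional_expectation E D B"
    and "crossed_product_like_amenable C A"
    and "cstar_dist A B < 1 / 140"
  shows "A = B"
proof -
  obtain E where E: "conditional_expectation E D B" using assms(11) by blast
  have near: "(SUP a\<in>unit_ball A. INF b\<in>unit_ball B. norm (a - b)) < 1"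
    "(SUP b\<in>unit_ball B. INF a\<in>unit_ball A. norm (b - a)) < 1 / 2"
    using assms(13) unfolding cstar_dist_def by (simp_all add: norm_minus_commute)
  have zero: "0 \<in> A" "0 \<in> B" using assms(3,6) unfolding cstar_subalgebra_def by auto
  obtain e where e: "e \<in> C" "is_unit_of e D"
    using assms(2) unfolding irreducible_inclusion_def unital_inclusion_def by blast
  have eA: "is_unit_of e A" using e assms(4,5) unfolding is_unit_of_def by blast
  obtain U where U: "U \<subseteq> cstar_normalizer C A" "A = cstar_subalgebra hull (C \<union> U)"
    using assms(12) unfolding crossed_product_like_amenable_def crossed_product_like_by_def by blast
  have "U \<subseteq> B"
  proof
    fix u assume "u \<in> U"
    then have u: "u \<in> A" "cadjoint u o\<^sub>L u = e" "u o\<^sub>L cadjoint u = e"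
      "(\<lambda>c. u o\<^sub>L c o\<^sub>L cadjoint u) ` C = C"
      using U(1) unfolding cstar_normalizer_def unitaries_def unit_of_eq[OF eA] by auto
    have "u \<in> unit_ball A"
      using norm_isometry_le[OF assms(3) eA u(1,2)] u(1) by (simp add: unit_ball_def)
    then obtain b where "b \<in> B" "norm (u - b) < 1"
      using near_inclusion[OF zero _ near(1)] by blast
    with u show "u \<in> B"
      using normalizer_in_image_of_expectation[OF assms(2) e(2,1) assms(6,7,8) E] assms(5) by blast
  qed
  then have "A \<subseteq> B"
    unfolding U(2) using assms(6,7) by (intro hull_minimal) auto
  show "A = B"
  proof (rule closed_subspace_eq_if_near[OF _ _ _ \<open>A \<subseteq> B\<close>])
    show "subspace A" "subspace B" using assms(3,6) by (auto intro: cstar_subalgebra_subspace)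
    show "closed A" using assms(3) unfolding cstar_subalgebra_def by blast
    fix x assume "x \<in> B" "norm x \<le> 1"
    then have "x \<in> unit_ball B" by (simp add: unit_ball_def)
    then show "\<exists>a\<in>A. norm (x - a) < 1 / 2"
      using near_inclusion[OF zero(2,1) _ near(2)] by blast
  qed
qed

end
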